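(* Let $m>m_1>0$ be integers with $d=\gcd(m,m_1)>1$. Then there exist $d$ linear differential operators $Q_0,\dots,Q_{d-1}$ of order $\frac{m}{d}$ with coefficients in $\mathbb{C}(x)$ such that $$M(m,m_1)=Q_0\cdots Q_{d-1},$$ where $M(m,m_1)$ is the Mellin operator.
   Context: Let $\theta=x\frac{d}{dx}$. For integers $m>m_1>0$, the Mellin operator $M(m,m_1)$ (associated with the trinomial equation $y^m+xy^{m_1}-1=0$) is the ordinary differential operator $$M(m,m_1)=\prod_{k=0}^{m_1-1}(m_1\theta+mk+1)\prod_{k=0}^{m-m_1-1}\big((m-m_1)\theta+mk-1\big)-(-1)^{m_1}m^m\frac{d^m}{dx^m}.$$ The product of operators is composition. *)

theory Defs
  imports Complex_Main "HOL-Computational_Algebra.Polynomial" "HOL-Computational_Algebra.Fraction_Field"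
begin

type_synonym ratfun = "complex poly fract"

lift_definition deriv_fract :: "'a::idom poly fract \<Rightarrow> 'a poly fract" is
  "\<lambda>p. (pderiv (fst p) * snd p - fst p * pderiv (snd p), snd p * snd p)"
proof -
  fix p q :: "'a poly \<times> 'a poly"
  assume "fractrel p q"
  then have nz: "snd p \<noteq> 0" "snd q \<noteq> 0" and e: "fst p * snd q = fst q * snd p"
    by (auto simp: fractrel_def)
  let ?a = "fst p" and ?b = "snd p" and ?c = "fst q" and ?d = "snd q"
  from e have "pderiv (?a * ?d) = pderiv (?c * ?b)" by simp
  then have e': "pderiv ?a * ?d + ?a * pderiv ?d = pderiv ?c * ?b + ?c * pderiv ?b"
    by (simp add: pderiv_mult algebra_simps)
  have "(pderiv ?a * ?b - ?a * pderiv ?b) * (?d * ?d)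
      = ?b * ?d * (pderiv ?a * ?d + ?a * pderiv ?d) - ?a * ?d * (?b * pderiv ?d + pderiv ?b * ?d)"
    by (simp add: algebra_simps)
  also have "\<dots> = ?b * ?d * (pderiv ?c * ?b + ?c * pderiv ?b) - ?c * ?b * (?b * pderiv ?d + pderiv ?b * ?d)"
    by (simp only: e e')
  also have "\<dots> = (pderiv ?c * ?d - ?c * pderiv ?d) * (?b * ?b)"
    by (simp add: algebra_simps)
  finally have "(pderiv ?a * ?b - ?a * pderiv ?b) * (?d * ?d) = (pderiv ?c * ?d - ?c * pderiv ?d) * (?b * ?b)" .
  then show "fractrel (pderiv ?a * ?b - ?a * pderiv ?b, ?b * ?b) (pderiv ?c * ?d - ?c * pderiv ?d, ?d * ?d)"
    using nz by (simp add: fractrel_def)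
qed

lemma deriv_fract_Fract:
  "b \<noteq> 0 \<Longrightarrow> deriv_fract (Fract a b) = Fract (pderiv a * b - a * pderiv b) (b * b)"
  by transfer simp

lemma deriv_fract_poly: "deriv_fract (Fract p 1) = Fract (pderiv p) 1"
  by (simp add: deriv_fract_Fract)

lemma deriv_fract_add: "deriv_fract (f + g) = deriv_fract f + deriv_fract g"
  by (cases f; cases g)
    (simp add: deriv_fract_Fract eq_fract pderiv_mult pderiv_add algebra_simps)

lemma deriv_fract_mult: "deriv_fract (f * g) = deriv_fract f * g + f * deriv_fract g"
  by (cases f; cases g)
    (simp add: deriv_fract_Fract eq_fract pderiv_mult algebra_simps)

definition ratfun_x :: ratfun where
  "ratfun_x = Fract [:0, 1:] 1"

(* A linear differential operator with coefficients in C(x) is identified with the additive map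
   on C(x) that it induces.  Nothing is lost, since C(x) has characteristic 0: the coefficients,
   and so the order, can be recovered from the map (diff_op_coeffs_unique, has_diff_order_unique). *)
type_synonym diff_op = "ratfun \<Rightarrow> ratfun"

definition has_diff_order :: "diff_op \<Rightarrow> nat \<Rightarrow> bool" where
  "has_diff_order L n \<longleftrightarrow>
     (\<exists>a :: nat \<Rightarrow> ratfun. a n \<noteq> 0 \<and> (\<forall>f. L f = (\<Sum>i\<le>n. a i * (deriv_fract ^^ i) f)))"

lemma deriv_fract_poly_power: "(deriv_fract ^^ i) (Fract p 1) = Fract ((pderiv ^^ i) p) 1"
  by (induction i) (simp_all add: deriv_fract_poly)

lemma higher_pderiv_diag: "(pderiv ^^ i) (monom (1::complex) i) = [:fact i:]"
  by (rule poly_eqI) (auto simp: coeff_higher_pderiv pochhammer_fact coeff_pCons split: nat.splits)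

lemma higher_pderiv_above: "j > i \<Longrightarrow> (pderiv ^^ j) (monom (1::complex) i) = 0"
  by (rule poly_eqI) (auto simp: coeff_higher_pderiv)

lemma diff_op_coeffs_zero:
  fixes a :: "nat \<Rightarrow> ratfun"
  assumes "\<forall>f. (\<Sum>i\<le>n. a i * (deriv_fract ^^ i) f) = 0"
  shows "i \<le> n \<Longrightarrow> a i = 0"
proof (induction i rule: less_induct)
  case (less i)
  let ?f = "Fract (monom 1 i) 1 :: ratfun"
  have "(\<Sum>j\<le>n. a j * (deriv_fract ^^ j) ?f) = (\<Sum>j\<le>n. if j = i then a i * Fract [:fact i:] 1 else 0)"
  proof (rule sum.cong)
    fix j assume "j \<in> {..n}"
    consider "j < i" | "j = i" | "j > i" by linarith
    then show "a j * (deriv_fract ^^ j) ?f = (if j = i then a i * Fract [:fact i:] 1 else 0)"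
    proof cases
      case 1
      then have "a j = 0" using less.IH [of j] less.prems by simp
      with 1 show ?thesis by simp
    next
      case 2
      then show ?thesis by (simp only: deriv_fract_poly_power higher_pderiv_diag simp_thms if_True)
    next
      case 3
      then have "(deriv_fract ^^ j) ?f = 0"
        by (simp only: deriv_fract_poly_power higher_pderiv_above fract_collapse)
      with 3 show ?thesis by simp
    qed
  qed simp
  also have "\<dots> = a i * Fract [:fact i:] 1"
    using less.prems by (subst sum.delta) auto
  finally have "a i * Fract [:fact i:] 1 = 0"
    using assms by metis
  moreover have "Fract [:fact i:] 1 \<noteq> (0 :: ratfun)"
    by (simp add: Zero_fract_def eq_fract)
  ultimately show ?case by simp
qed

lemma diff_op_coeffs_unique:
  fixes a b :: "nat \<Rightarrow> ratfun"
  assumes "\<forall>f. (\<Sum>i\<le>n. a i * (deriv_fract ^^ i) f) = (\<Sum>i\<le>n. b i * (deriv_fract ^^ i) f)"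
    and "i \<le> n"
  shows "a i = b i"
proof -
  have "(\<Sum>i\<le>n. (a i - b i) * (deriv_fract ^^ i) f) = 0" for f
    using assms(1) by (simp only: left_diff_distrib sum_subtractf right_minus_eq)
  then have "a i - b i = 0"
    using diff_op_coeffs_zero [where a = "\<lambda>i. a i - b i"] assms(2) by blast
  then show ?thesis by simp
qed

lemma has_diff_order_unique:
  assumes "has_diff_order L n" "has_diff_order L k"
  shows "n = k"
proof -
  have False if "has_diff_order L n" "has_diff_order L k" "n < k" for n k
  proof -
    from that obtain a where a: "\<And>f. L f = (\<Sum>i\<le>n. a i * (deriv_fract ^^ i) f)"
      unfolding has_diff_order_def by blast
    from that obtain b where b: "b k \<noteq> 0" "\<And>f. L f = (\<Sum>i\<le>k. b i * (deriv_fract ^^ i) f)"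
      unfolding has_diff_order_def by blast
    let ?a = "\<lambda>i. if i \<le> n then a i else 0"
    have "L f = (\<Sum>i\<le>k. ?a i * (deriv_fract ^^ i) f)" for f
      unfolding a using \<open>n < k\<close> by (intro sum.mono_neutral_cong_left) auto
    then have "\<forall>f. (\<Sum>i\<le>k. ?a i * (deriv_fract ^^ i) f) = (\<Sum>i\<le>k. b i * (deriv_fract ^^ i) f)"
      by (simp only: b(2) [symmetric] simp_thms)
    then have "?a k = b k"
      by (rule diff_op_coeffs_unique) simp
    with b(1) \<open>n < k\<close> show False by simp
  qed
  with assms show ?thesis by (metis linorder_neqE_nat)
qed

definition op_prod :: "('a \<Rightarrow> 'a) list \<Rightarrow> 'a \<Rightarrow> 'a" where
  "op_prod Ls = foldr (\<circ>) Ls id"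

definition theta :: diff_op where
  "theta f = ratfun_x * deriv_fract f"

definition mellin_op :: "nat \<Rightarrow> nat \<Rightarrow> diff_op" where
  "mellin_op m m1 f =
     op_prod (map (\<lambda>k g. of_nat m1 * theta g + (of_nat (m * k) + 1) * g) [0..<m1] @
              map (\<lambda>k g. of_nat (m - m1) * theta g + (of_nat (m * k) - 1) * g) [0..<m - m1]) f
     - (-1) ^ m1 * of_nat m ^ m * (deriv_fract ^^ m) f"

end

theory Submission
  imports Defs "HOL-Library.Multiset" "HOL-Computational_Algebra.Fundamental_Theorem_Algebra"
begin

text \<open>
  Write \<open>m = d n\<close>, \<open>m\<^sub>1 = d n\<^sub>1\<close>, \<open>m - m\<^sub>1 = d n\<^sub>2\<close> and \<open>X = D\<^sup>n\<close> with \<open>D = d/dx\<close>. Because \<open>D\<theta> = (\<theta> + 1)D\<close>,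
  moving \<open>X\<close> to the right past a factor \<open>m\<^sub>1\<theta> + m k + 1\<close> adds \<open>n m\<^sub>1 = m n\<^sub>1\<close> to its constant term, which
  amounts to replacing \<open>k\<close> by \<open>k + n\<^sub>1\<close>; likewise \<open>(m - m\<^sub>1)\<theta> + m k - 1\<close> turns into the factor with index
  \<open>k + n\<^sub>2\<close>. So if the commuting factors of the first part of the Mellin operator are grouped into \<open>d\<close>
  blocks \<open>C\<^sub>0, \<dots>, C\<^sub>d\<^sub>-\<^sub>1\<close>, each made of \<open>n\<^sub>1\<close> consecutive factors of the first kind and \<open>n\<^sub>2\<close> consecutive
  ones of the second kind, then \<open>X C\<^sub>q = C\<^sub>q\<^sub>+\<^sub>1 X\<close>, and \<open>M(m,m\<^sub>1) = C\<^sub>d\<^sub>-\<^sub>1 \<cdots> C\<^sub>0 - c X\<^sup>d\<close> for a constant \<open>c\<close>.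

  If \<open>X\<close> were invertible, then \<open>W = C\<^sub>d\<^sub>-\<^sub>1 X\<^sup>-\<^sup>1\<close> would satisfy \<open>W\<^sup>k X\<^sup>d = C\<^sub>d\<^sub>-\<^sub>1 \<cdots> C\<^sub>d\<^sub>-\<^sub>k X\<^sup>d\<^sup>-\<^sup>k\<close>, so that
  \<open>M(m,m\<^sub>1) = (W\<^sup>d - c) X\<^sup>d\<close>. Over the complex numbers \<open>w\<^sup>d - c\<close> is a product of linear factors
  \<open>w - g\<^sub>i\<close>, and distributing the powers of \<open>X\<close> over \<open>\<Prod>(W - g\<^sub>i) X\<^sup>d\<close> gives
  \<open>M(m,m\<^sub>1) = (C\<^sub>d\<^sub>-\<^sub>1 - g\<^sub>0 X)(C\<^sub>d\<^sub>-\<^sub>2 - g\<^sub>1 X) \<cdots> (C\<^sub>0 - g\<^sub>d\<^sub>-\<^sub>1 X)\<close>.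
  The lemma \<open>staircase_power_minus_const_factorization\<close> proves this without inverting \<open>X\<close>. It holds for
  any linear maps that satisfy the intertwining relation.

  Each factor has order \<open>n\<close>: the coefficient of \<open>D\<^sup>n\<close> in \<open>C\<^sub>q - g X\<close> is \<open>a x\<^sup>n - g\<close> with a constant
  \<open>a \<noteq> 0\<close>, and this does not vanish because \<open>n > 0\<close>.
\<close>

section \<open>Factoring along an intertwining relation\<close>

lemma op_prod_Nil [simp]: "op_prod [] = id"
  by (simp add: op_prod_def)

lemma op_prod_Cons [simp]: "op_prod (F # Fs) = F \<circ> op_prod Fs"
  by (simp add: op_prod_def)

lemma op_prod_append: "op_prod (Fs @ Gs) = op_prod Fs \<circ> op_prod Gs"
  by (induction Fs) (simp_all add: comp_assoc)

text \<open>The operator \<open>C\<^sub>l\<^sub>+\<^sub>k\<^sub>-\<^sub>1 \<cdots> C\<^sub>l X\<^sup>l\<close>, which stands for \<open>W\<^sup>k X\<^sup>k\<^sup>+\<^sup>l\<close> with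
  \<open>W = C\<^sub>l\<^sub>+\<^sub>k\<^sub>-\<^sub>1 X\<^sup>-\<^sup>1\<close>. The two indices avoid a subtraction on natural numbers.\<close>

primrec staircase :: "(nat \<Rightarrow> 'b \<Rightarrow> 'b) \<Rightarrow> ('b \<Rightarrow> 'b) \<Rightarrow> nat \<Rightarrow> nat \<Rightarrow> 'b \<Rightarrow> 'b" where
  "staircase C X 0 l = X ^^ l"
| "staircase C X (Suc k) l = C (l + k) \<circ> staircase C X k l"

locale intertwined_maps = module scale
  for scale :: "'a::comm_ring_1 \<Rightarrow> 'b::ab_group_add \<Rightarrow> 'b" +
  fixes C :: "nat \<Rightarrow> 'b \<Rightarrow> 'b" and X :: "'b \<Rightarrow> 'b"
  assumes comm: "X \<circ> C q = C (Suc q) \<circ> X"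
    and linX: "module_hom scale scale X"
    and linC: "module_hom scale scale (C q)"
begin

text \<open>A denominator-free form of \<open>p(W) X\<^sup>N\<close> with \<open>W = C\<^sub>N\<^sub>-\<^sub>1 X\<^sup>-\<^sup>1\<close>. It has this meaning for polynomials \<open>p\<close>
  of degree at most \<open>N\<close>.\<close>

definition staircase_poly :: "nat \<Rightarrow> 'a poly \<Rightarrow> 'b \<Rightarrow> 'b" where
  "staircase_poly N p f = (\<Sum>k\<le>N. scale (coeff p k) (staircase C X k (N - k) f))"

lemma staircase_shift: "X (staircase C X k l f) = staircase C X k (Suc l) f"
proof (induction k)
  case (Suc k)
  have "X (C q g) = C (Suc q) (X g)" for q g
    using comm [of q] by (simp add: fun_eq_iff)
  with Suc show ?case by simp
qed simp

text \<open>Applying \<open>C\<^sub>N\<close> prolongs every staircase at the top, which shifts the coefficients of \<open>p\<close> by one place.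
  Applying \<open>X\<close> lifts every staircase by one index and leaves the coefficients where they are. The two
  effects combine to the multiplication of \<open>p\<close> by \<open>w - g\<close>, where \<open>w\<close> is its variable.\<close>

lemma staircase_poly_step:
  assumes deg: "degree p \<le> N"
  shows "C N (staircase_poly N p f) - scale g (X (staircase_poly N p f))
       = staircase_poly (Suc N) ([:- g, 1:] * p) f"
proof -
  interpret X: module_hom scale scale X by (rule linX)
  interpret C: module_hom scale scale "C N" by (rule linC)
  let ?D = "staircase C X"
  have "C N (staircase_poly N p f) = (\<Sum>k\<le>N. scale (coeff p k) (?D (Suc k) (N - k) f))"
    by (simp add: staircase_poly_def C.sum C.scale)
  also have "\<dots> = (\<Sum>k\<le>Suc N. scale (coeff (pCons 0 p) k) (?D k (Suc N - k) f))"
    by (subst sum.atMost_Suc_shift) simp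
  finally have 1: "C N (staircase_poly N p f)
      = (\<Sum>k\<le>Suc N. scale (coeff (pCons 0 p) k) (?D k (Suc N - k) f))" .
  have "X (staircase_poly N p f) = (\<Sum>k\<le>N. scale (coeff p k) (?D k (Suc N - k) f))"
    unfolding staircase_poly_def X.sum X.scale
    by (intro sum.cong) (simp_all add: staircase_shift Suc_diff_le)
  also have "\<dots> = (\<Sum>k\<le>Suc N. scale (coeff p k) (?D k (Suc N - k) f))"
    using deg by (simp add: coeff_eq_0)
  finally have 2: "X (staircase_poly N p f)
      = (\<Sum>k\<le>Suc N. scale (coeff p k) (?D k (Suc N - k) f))" .
  have "[:- g, 1:] * p = pCons 0 p - smult g p"
    by simp
  then show ?thesis
    unfolding 1 2 scale_sum_right sum_subtractf [symmetric]
    unfolding staircase_poly_def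
    by (intro sum.cong) (simp_all add: scale_left_diff_distrib)
qed

lemma op_prod_eq_staircase_poly:
  shows "op_prod (map (\<lambda>i f. C (length gs - Suc i) f - scale (gs ! i) (X f)) [0..<length gs])
       = staircase_poly (length gs) (\<Prod>g\<leftarrow>gs. [:- g, 1:])"
proof (induction gs)
  case Nil
  show ?case by (simp add: fun_eq_iff staircase_poly_def)
next
  case (Cons g gs)
  let ?p = "\<Prod>g\<leftarrow>gs. [:- g, 1:]"
  have deg: "degree ?p \<le> length gs"
  proof (induction gs)
    case (Cons h hs)
    then show ?case
      using degree_mult_le [of "[:- h, 1:]" "\<Prod>g\<leftarrow>hs. [:- g, 1:]"] by (simp split: if_splits)
  qed simp
  have upt: "[0..<length (g # gs)] = 0 # map Suc [0..<length gs]"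
    by (metis length_Cons map_Suc_upt upt_conv_Cons zero_less_Suc)
  have "op_prod (map (\<lambda>i f. C (length (g # gs) - Suc i) f - scale ((g # gs) ! i) (X f))
            [0..<length (g # gs)])
      = (\<lambda>f. C (length gs) f - scale g (X f)) \<circ> staircase_poly (length gs) ?p"
    unfolding upt by (simp add: o_def flip: Cons.IH)
  also have "\<dots> = staircase_poly (length (g # gs)) (\<Prod>g\<leftarrow>g # gs. [:- g, 1:])"
    using staircase_poly_step [OF deg] by (simp add: fun_eq_iff)
  finally show ?case .
qed

text \<open>Only the two extreme staircases, \<open>C\<^sub>d\<^sub>-\<^sub>1 \<cdots> C\<^sub>0\<close> and \<open>X\<^sup>d\<close>, survive for the polynomial \<open>w\<^sup>d - c\<close>. The product
  on the left depends on the linear factors of that polynomial only through their product.\<close>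

lemma staircase_power_minus_const_factorization:
  assumes gs: "(\<Prod>g\<leftarrow>gs. [:- g, 1:]) = monom 1 (length gs) - [:c:]"
    and nz: "0 < length gs"
  shows "op_prod (map (\<lambda>i f. C (length gs - Suc i) f - scale (gs ! i) (X f)) [0..<length gs])
       = (\<lambda>f. staircase C X (length gs) 0 f - scale c ((X ^^ length gs) f))"
proof
  fix f
  let ?N = "length gs" and ?D = "staircase C X"
  have "staircase_poly ?N (monom 1 ?N - [:c:]) f
      = (\<Sum>k\<le>?N. (if k = ?N then ?D k (?N - k) f else 0) - (if k = 0 then scale c (?D k (?N - k) f) else 0))"
    unfolding staircase_poly_def
    by (intro sum.cong) (auto simp: scale_left_diff_distrib coeff_pCons split: nat.splits)
  also have "\<dots> = ?D ?N 0 f - scale c ((X ^^ ?N) f)"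
    by (simp add: sum_subtractf)
  finally show "op_prod (map (\<lambda>i f. C (length gs - Suc i) f - scale (gs ! i) (X f)) [0..<length gs]) f
       = ?D ?N 0 f - scale c ((X ^^ ?N) f)"
    by (simp only: op_prod_eq_staircase_poly gs)
qed

end

lemma monom_minus_const_splits:
  fixes c :: "'a :: alg_closed_field"
  assumes "0 < d"
  obtains gs where "length gs = d" "(\<Prod>g\<leftarrow>gs. [:- g, 1:]) = monom 1 d - [:c:]"
proof -
  let ?p = "monom 1 d - [:c:]"
  have deg: "degree ?p = d"
    using assms degree_add_eq_left [of "- [:c:]" "monom 1 d"]
    by (simp add: degree_monom_eq del: minus_pCons)
  then have lc: "lead_coeff ?p = 1"
    using assms by (cases d) auto
  then have "?p \<noteq> 0" by fastforce
  from alg_closed_imp_factorization [OF this]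
  obtain A where A: "size A = d" "?p = (\<Prod>x\<in>#A. [:- x, 1:])"
    unfolding lc smult_1_left unfolding deg by blast
  obtain gs where "mset gs = A" using ex_mset by blast
  with A have "length gs = d" "(\<Prod>g\<leftarrow>gs. [:- g, 1:]) = ?p"
    by (auto simp flip: prod_mset_prod_list)
  then show thesis by (rule that)
qed

section \<open>First-order factors in the Euler operator\<close>

definition cscale :: "complex \<Rightarrow> ratfun \<Rightarrow> ratfun" where
  "cscale c f = Fract [:c:] 1 * f"

lemma Fract_const_of_nat: "Fract [:of_nat n:] 1 = (of_nat n :: ratfun)"
  by (simp add: of_nat_fract of_nat_poly)

interpretation ratfun: module cscale
proof
  fix a b :: complex and f g :: ratfun
  have "Fract [:a + b:] 1 = (Fract [:a:] 1 + Fract [:b:] 1 :: ratfun)"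
    by simp
  then show "cscale (a + b) f = cscale a f + cscale b f"
    by (simp only: cscale_def distrib_right)
  show "cscale a (f + g) = cscale a f + cscale a g"
    by (simp only: cscale_def distrib_left)
  have "Fract [:a * b:] 1 = (Fract [:a:] 1 * Fract [:b:] 1 :: ratfun)"
    by (simp add: mult.commute)
  then show "cscale a (cscale b f) = cscale (a * b) f"
    by (simp only: cscale_def mult.assoc)
  show "cscale 1 f = f"
    by (simp add: cscale_def One_fract_def [symmetric] one_pCons [symmetric])
qed

lemma deriv_fract_cscale: "deriv_fract (cscale c f) = cscale c (deriv_fract f)"
  by (simp add: cscale_def deriv_fract_mult deriv_fract_poly pderiv_pCons
      Zero_fract_def [symmetric])

lemma theta_add: "theta (f + g) = theta f + theta g"
  by (simp add: theta_def deriv_fract_add algebra_simps)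

lemma theta_cscale: "theta (cscale c f) = cscale c (theta f)"
  by (simp add: theta_def deriv_fract_cscale) (simp add: cscale_def)

lemma deriv_fract_theta: "deriv_fract (theta f) = theta (deriv_fract f) + deriv_fract f"
proof -
  have "deriv_fract ratfun_x = 1"
    by (simp add: ratfun_x_def deriv_fract_poly pderiv_pCons One_fract_def [symmetric]
        one_pCons [symmetric])
  then show ?thesis by (simp add: theta_def deriv_fract_mult)
qed

text \<open>The operators \<open>a\<theta> + b\<close> are encoded by their coefficient pairs, so that reordering and shifting factors
  becomes an operation on lists of pairs.\<close>

definition euler_factor :: "complex \<times> complex \<Rightarrow> diff_op" where
  "euler_factor = (\<lambda>(a, b) f. cscale a (theta f) + cscale b f)"

lemma euler_factor_add: "euler_factor p (f + g) = euler_factor p f + euler_factor p g"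
  by (cases p) (simp add: euler_factor_def theta_add ratfun.scale_right_distrib)

lemma euler_factor_cscale: "euler_factor p (cscale c f) = cscale c (euler_factor p f)"
  by (cases p) (simp add: euler_factor_def theta_cscale ratfun.scale_right_distrib mult.commute)

lemma euler_factor_commute:
  "euler_factor p \<circ> euler_factor q = euler_factor q \<circ> euler_factor p"
  by (auto simp: fun_eq_iff euler_factor_def theta_add theta_cscale split: prod.splits)
     (simp add: cscale_def algebra_simps)

text \<open>This is \<open>D\<theta> = (\<theta> + 1)D\<close>, iterated \<open>n\<close> times.\<close>

lemma funpow_deriv_fract_euler_factor:
  "(deriv_fract ^^ n) (euler_factor (a, b) f) = euler_factor (a, b + of_nat n * a) ((deriv_fract ^^ n) f)"
proof (induction n)
  case (Suc n)
  then show ?case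
    by (simp add: euler_factor_def deriv_fract_add deriv_fract_cscale deriv_fract_theta
        ratfun.scale_left_distrib ratfun.scale_right_distrib algebra_simps)
qed simp

lemma funpow_deriv_fract_op_prod_euler_factors:
  "(deriv_fract ^^ n) \<circ> op_prod (map euler_factor ps)
     = op_prod (map euler_factor (map (\<lambda>(a, b). (a, b + of_nat n * a)) ps)) \<circ> (deriv_fract ^^ n)"
  by (induction ps)
    (auto simp: fun_eq_iff funpow_deriv_fract_euler_factor)

lemma module_hom_funpow_deriv_fract: "module_hom cscale cscale (deriv_fract ^^ n)"
proof (induction n)
  case 0
  show ?case by unfold_locales simp_all
next
  case (Suc n)
  then interpret module_hom cscale cscale "deriv_fract ^^ n" .
  show ?case
    by unfold_locales (simp_all add: add scale deriv_fract_add deriv_fract_cscale)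
qed

lemma module_hom_op_prod_euler_factors: "module_hom cscale cscale (op_prod (map euler_factor ps))"
proof (induction ps)
  case Nil
  show ?case by unfold_locales simp_all
next
  case (Cons p ps)
  then interpret module_hom cscale cscale "op_prod (map euler_factor ps)" .
  show ?case
    by unfold_locales (simp_all add: add scale euler_factor_add euler_factor_cscale)
qed

lemma op_prod_euler_factors_permute:
  assumes "mset ps = mset qs"
  shows "op_prod (map euler_factor ps) = op_prod (map euler_factor qs)"
proof -
  have fold: "op_prod (map euler_factor ps) = fold euler_factor (rev ps)" for ps
    by (induction ps) simp_all
  show ?thesis
    unfolding fold using assms
    by (intro fold_multiset_equiv) (simp_all add: euler_factor_commute)
qed

section \<open>Orders and leading coefficients\<close>

text \<open>Unlike \<^const>\<open>has_diff_order\<close>, this relation records the leading coefficient and lets it be zero. It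
  is therefore preserved by linear combinations, and the non-vanishing is checked only once, at the end.\<close>

definition has_leading_term :: "diff_op \<Rightarrow> nat \<Rightarrow> ratfun \<Rightarrow> bool" where
  "has_leading_term L n l \<longleftrightarrow>
     (\<exists>a. a n = l \<and> (\<forall>f. L f = (\<Sum>i\<le>n. a i * (deriv_fract ^^ i) f)))"

lemma has_leading_term_imp_diff_order:
  "has_leading_term L n l \<Longrightarrow> l \<noteq> 0 \<Longrightarrow> has_diff_order L n"
  unfolding has_leading_term_def has_diff_order_def by metis

lemma has_leading_term_funpow_deriv: "has_leading_term (deriv_fract ^^ n) n 1"
  unfolding has_leading_term_def
  by (rule exI [of _ "\<lambda>i. if i = n then 1 else 0"]) (simp add: if_distrib [of "\<lambda>x. x * _"] cong: if_cong)

lemma has_leading_term_diff_cscale: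
  assumes "has_leading_term L n l" and "has_leading_term K n k"
  shows "has_leading_term (\<lambda>f. L f - cscale c (K f)) n (l - cscale c k)"
proof -
  obtain a where a: "a n = l" "\<And>f. L f = (\<Sum>i\<le>n. a i * (deriv_fract ^^ i) f)"
    using assms(1) unfolding has_leading_term_def by blast
  obtain b where b: "b n = k" "\<And>f. K f = (\<Sum>i\<le>n. b i * (deriv_fract ^^ i) f)"
    using assms(2) unfolding has_leading_term_def by blast
  have "L f - cscale c (K f) = (\<Sum>i\<le>n. (a i - cscale c (b i)) * (deriv_fract ^^ i) f)" for f
    by (simp only: a(2) b(2) cscale_def sum_distrib_left sum_subtractf left_diff_distrib mult.assoc)
  then show ?thesis
    unfolding has_leading_term_def using a(1) b(1)
    by (intro exI [of _ "\<lambda>i. a i - cscale c (b i)"]) simp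
qed

lemma deriv_fract_sum:
  fixes f :: "'i \<Rightarrow> ratfun"
  shows "deriv_fract (\<Sum>i\<in>A. f i) = (\<Sum>i\<in>A. deriv_fract (f i))"
proof -
  interpret module_hom cscale cscale "deriv_fract ^^ 1"
    by (rule module_hom_funpow_deriv_fract)
  show ?thesis using sum [of f A] by simp
qed

text \<open>The product rule for \<open>\<theta>(u\<^sub>i D\<^sup>i)\<close> gives \<open>x u\<^sub>i' D\<^sup>i + x u\<^sub>i D\<^sup>i\<^sup>+\<^sup>1\<close>; only the second term with \<open>i = n\<close>
  reaches order \<open>n + 1\<close>.\<close>

lemma has_leading_term_euler_factor:
  assumes "has_leading_term L n l"
  shows "has_leading_term (euler_factor (a, b) \<circ> L) (Suc n) (cscale a (ratfun_x * l))"
proof -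
  obtain u where u: "u n = l" "\<And>f. L f = (\<Sum>i\<le>n. u i * (deriv_fract ^^ i) f)"
    using assms unfolding has_leading_term_def by blast
  let ?A = "Fract [:a:] 1 :: ratfun" and ?B = "Fract [:b:] 1 :: ratfun"
  define v where "v i = ?A * ratfun_x * deriv_fract (u i) + ?B * u i" for i
  define w where "w i = (if i \<le> n then v i else 0) + (case i of 0 \<Rightarrow> 0 | Suc j \<Rightarrow> ?A * ratfun_x * u j)" for i
  have "euler_factor (a, b) (L f) = (\<Sum>i\<le>Suc n. w i * (deriv_fract ^^ i) f)" for f
  proof -
    have "euler_factor (a, b) (L f)
        = (\<Sum>i\<le>n. v i * (deriv_fract ^^ i) f) + (\<Sum>i\<le>n. ?A * ratfun_x * u i * (deriv_fract ^^ Suc i) f)"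
      by (simp add: euler_factor_def cscale_def theta_def u(2) deriv_fract_sum deriv_fract_mult
          sum_distrib_left v_def flip: sum.distrib) (simp add: algebra_simps)
    also have "(\<Sum>i\<le>n. v i * (deriv_fract ^^ i) f)
        = (\<Sum>i\<le>Suc n. (if i \<le> n then v i else 0) * (deriv_fract ^^ i) f)"
      by simp
    also have "(\<Sum>i\<le>n. ?A * ratfun_x * u i * (deriv_fract ^^ Suc i) f)
        = (\<Sum>i\<le>Suc n. (case i of 0 \<Rightarrow> 0 | Suc j \<Rightarrow> ?A * ratfun_x * u j) * (deriv_fract ^^ i) f)"
      by (subst sum.atMost_Suc_shift) simp
    finally show ?thesis
      by (simp only: w_def distrib_right sum.distrib)
  qed
  moreover have "w (Suc n) = cscale a (ratfun_x * l)"
    by (simp add: w_def u(1) cscale_def)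
  ultimately show ?thesis
    unfolding has_leading_term_def by (intro exI [of _ w]) simp
qed

lemma has_leading_term_op_prod_euler_factors:
  "has_leading_term (op_prod (map euler_factor ps)) (length ps)
     (Fract (monom (\<Prod>p\<leftarrow>ps. fst p) (length ps)) 1)"
proof (induction ps)
  case Nil
  show ?case
    using has_leading_term_funpow_deriv [of 0] by (simp add: One_fract_def id_def)
next
  case (Cons p ps)
  have "cscale (fst p) (ratfun_x * Fract (monom (\<Prod>p\<leftarrow>ps. fst p) (length ps)) 1)
      = Fract (monom (\<Prod>p\<leftarrow>p # ps. fst p) (length (p # ps))) 1"
    by (simp add: cscale_def ratfun_x_def monom_Suc smult_monom)
  then show ?case
    using has_leading_term_euler_factor [OF Cons.IH, of "fst p" "snd p"] by (simp add: o_def)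
qed

text \<open>The leading coefficient is \<open>a x\<^sup>n - g\<close>, where \<open>n > 0\<close> is the number of factors and \<open>a \<noteq> 0\<close> the product of the
  coefficients of \<open>\<theta>\<close>. A constant \<open>g\<close> cannot cancel it.\<close>

lemma has_diff_order_euler_factors_minus_deriv:
  assumes "ps \<noteq> []" and "\<forall>p\<in>set ps. fst p \<noteq> 0"
  shows "has_diff_order (\<lambda>f. op_prod (map euler_factor ps) f
           - cscale g ((deriv_fract ^^ length ps) f)) (length ps)"
proof (rule has_leading_term_imp_diff_order)
  let ?a = "\<Prod>p\<leftarrow>ps. fst p"
  show "has_leading_term (\<lambda>f. op_prod (map euler_factor ps) f
      - cscale g ((deriv_fract ^^ length ps) f)) (length ps)
      (Fract (monom ?a (length ps)) 1 - cscale g 1)"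
    by (intro has_leading_term_diff_cscale has_leading_term_op_prod_euler_factors
        has_leading_term_funpow_deriv)
  have "?a \<noteq> 0"
    using assms(2) by (auto simp: prod_list_zero_iff)
  moreover have "coeff (monom ?a (length ps)) (length ps) \<noteq> coeff [:g:] (length ps)" if "?a \<noteq> 0"
    using that assms(1) by (cases ps) auto
  ultimately have "monom ?a (length ps) \<noteq> [:g:]" by metis
  then show "Fract (monom ?a (length ps)) 1 - cscale g 1 \<noteq> (0 :: ratfun)"
    by (simp add: cscale_def eq_fract del: diff_fract)
qed

section \<open>Splitting the Mellin operator into blocks\<close>

lemma mset_map_upt_blocks:
  "mset (map h [0..<d * n]) = (\<Sum>q<d. mset (map (\<lambda>r. h (q * n + r)) [0..<n]))"
proof (induction d)
  case (Suc d)
  have "[0..<d * n + n] = [0..<d * n] @ [d * n..<d * n + n]"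
    by (rule upt_add_eq_append) simp
  also have "[d * n..<d * n + n] = map (\<lambda>r. d * n + r) [0..<n]"
    by (intro nth_equalityI) simp_all
  finally have "[0..<Suc d * n] = [0..<d * n] @ map (\<lambda>r. d * n + r) [0..<n]"
    by (simp only: mult_Suc add.commute [of n])
  then show ?case
    by (simp only: Suc sum.lessThan_Suc map_append mset_append map_map o_def)
qed simp

text \<open>Euler factors commute, so any distribution of them into \<open>d\<close> blocks yields the same product.\<close>

lemma op_prod_euler_factors_eq_staircase:
  assumes "mset ps = (\<Sum>q<d. mset (B q))"
  shows "op_prod (map euler_factor ps) = staircase (\<lambda>q. op_prod (map euler_factor (B q))) X d 0"
  using assms
proof (induction d arbitrary: ps)
  case (Suc d)
  obtain qs where qs: "mset qs = (\<Sum>q<d. mset (B q))" using ex_mset by blast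
  with Suc.prems have "op_prod (map euler_factor ps) = op_prod (map euler_factor (B d @ qs))"
    by (intro op_prod_euler_factors_permute) simp
  then show ?case
    by (simp add: op_prod_append Suc.IH [OF qs])
qed simp

theorem proposition5p5:
  fixes m m1 d :: nat
  assumes "0 < m1" and "m1 < m" and "d = gcd m m1" and "d > 1"
  shows "\<exists>Q :: nat \<Rightarrow> diff_op.
           (\<forall>i<d. has_diff_order (Q i) (m div d)) \<and>
           mellin_op m m1 = op_prod (map Q [0..<d])"
proof -
  define n n1 n2 where "n = m div d" and "n1 = m1 div d" and "n2 = n - n1"
  have m: "m = d * n" and m1: "m1 = d * n1"
    using assms(3) by (simp_all add: n_def n1_def)
  have m2: "m - m1 = d * n2"
    by (simp add: m m1 n2_def diff_mult_distrib2)
  have n12: "0 < n1" "0 < n2" "n = n1 + n2"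
    using assms(1,2,4) by (auto simp: m m1 n2_def)
  define h1 h2 :: "nat \<Rightarrow> complex \<times> complex"
    where "h1 k = (of_nat m1, of_nat (m * k) + 1)"
      and "h2 k = (of_nat (m - m1), of_nat (m * k) - 1)" for k
  define B where "B q = map (\<lambda>r. h1 (q * n1 + r)) [0..<n1] @ map (\<lambda>r. h2 (q * n2 + r)) [0..<n2]" for q
  define C where "C q = op_prod (map euler_factor (B q))" for q
  define X where "X = (deriv_fract ^^ n :: diff_op)"
  define c :: complex where "c = (-1) ^ m1 * of_nat m ^ m"

  \<comment> \<open>The identities \<open>n m\<^sub>1 = m n\<^sub>1\<close> and \<open>n (m - m\<^sub>1) = m n\<^sub>2\<close> are what makes the shift caused by
    \<open>X\<close> hit the next block exactly.\<close>
  have shift: "map (\<lambda>(a, b). (a, b + of_nat n * a)) (B q) = B (Suc q)" for q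
  proof -
    have "n * m1 = m * n1" "n * (m - m1) = m * n2"
      by (simp_all only: m2) (simp_all add: m m1)
    then have "of_nat n * of_nat m1 = (of_nat m * of_nat n1 :: complex)"
      "of_nat n * of_nat (m - m1) = (of_nat m * of_nat n2 :: complex)"
      by (metis of_nat_mult)+
    then show ?thesis
      by (simp add: B_def h1_def h2_def algebra_simps)
  qed
  have comm: "X \<circ> C q = C (Suc q) \<circ> X" for q
    unfolding X_def C_def funpow_deriv_fract_op_prod_euler_factors shift ..
  have linX: "module_hom cscale cscale X"
    unfolding X_def by (rule module_hom_funpow_deriv_fract)
  have linC: "module_hom cscale cscale (C q)" for q
    unfolding C_def by (rule module_hom_op_prod_euler_factors)
  interpret intertwined: intertwined_maps cscale C X
    by (intro intertwined_maps.intro intertwined_maps_axioms.intro ratfun.module_axioms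
        comm linX linC)
  have "0 < d" using assms(4) by simp
  then obtain gs where gs: "length gs = d" "(\<Prod>g\<leftarrow>gs. [:- g, 1:]) = monom 1 d - [:c:]"
    by (rule monom_minus_const_splits)
  define Q where "Q i f = C (d - Suc i) f - cscale (gs ! i) (X f)" for i f

  have "mset (map h1 [0..<m1] @ map h2 [0..<m - m1]) = (\<Sum>q<d. mset (B q))"
    unfolding m2 unfolding m1 by (simp only: mset_append mset_map_upt_blocks B_def sum.distrib)
  then have "op_prod (map euler_factor (map h1 [0..<m1] @ map h2 [0..<m - m1])) = staircase C X d 0"
    unfolding C_def by (rule op_prod_euler_factors_eq_staircase)
  moreover have "map (\<lambda>k g. of_nat m1 * theta g + (of_nat (m * k) + 1) * g) [0..<m1] @
        map (\<lambda>k g. of_nat (m - m1) * theta g + (of_nat (m * k) - 1) * g) [0..<m - m1]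
      = map euler_factor (map h1 [0..<m1] @ map h2 [0..<m - m1])"
  proof -
    have "cscale (of_nat k) f = of_nat k * f" for k f
      by (simp add: cscale_def Fract_const_of_nat)
    then show ?thesis
      by (simp add: euler_factor_def h1_def h2_def fun_eq_iff ratfun.scale_left_distrib
        ratfun.scale_left_diff_distrib distrib_right left_diff_distrib del: of_nat_mult of_nat_diff)
  qed
  moreover have "(-1) ^ m1 * of_nat m ^ m * f = cscale c f" for f
  proof -
    have pow: "cscale (a ^ k) 1 = cscale a 1 ^ k" for a k
    proof (induction k)
      case (Suc k)
      then show ?case
        by (simp flip: ratfun.scale_scale) (simp add: cscale_def)
    qed simp
    have "cscale c f = cscale ((-1) ^ m1) 1 * cscale (of_nat m ^ m) 1 * f"
      by (simp add: c_def cscale_def mult.commute)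
    moreover have "cscale (- 1) 1 = - 1"
      by (simp only: ratfun.scale_minus_left ratfun.scale_one)
    moreover have "cscale (of_nat m) 1 = of_nat m"
      by (simp add: cscale_def Fract_const_of_nat)
    ultimately show ?thesis
      by (simp only: pow)
  qed
  moreover have "deriv_fract ^^ m = X ^^ d"
    by (simp add: X_def funpow_mult m mult.commute)
  ultimately have "mellin_op m m1 = (\<lambda>f. staircase C X d 0 f - cscale c ((X ^^ d) f))"
    by (simp only: mellin_op_def fun_eq_iff simp_thms)
  also have "\<dots> = op_prod (map Q [0..<d])"
    using intertwined.staircase_power_minus_const_factorization [of gs c] gs \<open>0 < d\<close>
    by (simp add: Q_def [abs_def])
  finally have "mellin_op m m1 = op_prod (map Q [0..<d])" .
  moreover have "has_diff_order (Q i) (m div d)" for i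
  proof -
    have "length (B (d - Suc i)) = n" "B (d - Suc i) \<noteq> []" "\<forall>p\<in>set (B (d - Suc i)). fst p \<noteq> 0"
      using n12 assms(1,2) by (auto simp: B_def h1_def h2_def)
    then show ?thesis
      using has_diff_order_euler_factors_minus_deriv [of "B (d - Suc i)" "gs ! i"]
      by (simp add: Q_def [abs_def] C_def X_def n_def)
  qed
  ultimately show ?thesis by blast
qed

end
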